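(* Let $S(t)$ be a Lipschitz curve in $CS^d_n$ defined on an interval $I\subseteq\mathbb{R}$. Then there exist Lipschitz functions $x_1(t),\dots,x_n(t):I\to\mathbb{R}^d$ such that $\sigma(S(t))=\{x_i(t):1\le i\le n\}$ for all $t\in I$.
   Context: $CS^d_n$ is the set of $d$-tuples $S=(S^1,\dots,S^d)$ of pairwise-commuting $n\times n$ self-adjoint (complex Hermitian) matrices, with norm $\|S\|=\max_{1\le r\le d}\|S^r\|$, where $\|S^r\|$ is the operator norm (Lipschitz curves are Lipschitz with respect to this norm). For $S\in CS^d_n$ there is a unitary $U$ with $S^r=U\operatorname{diag}(x_1^r,\dots,x_n^r)U^*$ for all $1\le r\le d$; the joint spectrum of $S$ is $\sigma(S):=\{x_i=(x_i^1,\dots,x_i^d):1\le i\le n\}\subset\mathbb{R}^d$. On $\mathbb{R}^d$ use $\|x\|=\max_r|x^r|$. *)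

theory Defs
  imports "HOL-Analysis.Analysis"
begin

text \<open>The size \<open>n\<close> and the number \<open>d\<close> of matrices are the cardinalities of the index types
  \<open>'n\<close> and \<open>'d\<close>.\<close>

definition ctranspose :: "complex ^ 'n ^ 'm \<Rightarrow> complex ^ 'm ^ 'n" where
  "ctranspose A = (\<chi> i j. cnj (A $ j $ i))"

definition self_adjoint :: "complex ^ 'n ^ 'n \<Rightarrow> bool" where
  "self_adjoint A \<longleftrightarrow> ctranspose A = A"

definition unitary :: "complex ^ 'n ^ 'n \<Rightarrow> bool" where
  "unitary U \<longleftrightarrow> U ** ctranspose U = mat 1 \<and> ctranspose U ** U = mat 1"

definition diag_mat :: "('n \<Rightarrow> complex) \<Rightarrow> complex ^ 'n ^ 'n" where
  "diag_mat c = (\<chi> i j. if i = j then c i else 0)"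

definition commuting_self_adjoint :: "(complex ^ 'n ^ 'n ^ 'd) set" where
  "commuting_self_adjoint =
     {S. (\<forall>r. self_adjoint (S $ r)) \<and> (\<forall>r s. S $ r ** S $ s = S $ s ** S $ r)}"

text \<open>\<open>onorm\<close> is taken with respect to the Hermitian norm on \<open>complex ^ 'n\<close>. The type class
  \<open>norm\<close> on nested vectors is the Euclidean norm, hence not the one wanted here.
  The norm \<open>max_r |x^r|\<close> on \<open>real ^ 'd\<close> is the library's \<open>infnorm\<close>.\<close>

definition tuple_norm :: "complex ^ 'n ^ 'n ^ 'd \<Rightarrow> real" where
  "tuple_norm S = Max (range (\<lambda>r. onorm (\<lambda>v. S $ r *v v)))"

definition simul_diag ::
    "complex ^ 'n ^ 'n ^ 'd \<Rightarrow> complex ^ 'n ^ 'n \<Rightarrow> ('n \<Rightarrow> real ^ 'd) \<Rightarrow> bool" where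
  "simul_diag S U x \<longleftrightarrow> unitary U \<and>
     (\<forall>r. S $ r = U ** diag_mat (\<lambda>i. complex_of_real (x i $ r)) ** ctranspose U)"

text \<open>The set \<open>range x\<close> is the same for every simultaneous diagonalization of \<open>S\<close>
  (lemma \<open>joint_spectrum_eq\<close>), so the union over all of them makes no choice.\<close>

definition joint_spectrum :: "complex ^ 'n ^ 'n ^ 'd \<Rightarrow> (real ^ 'd) set" where
  "joint_spectrum S = \<Union>{range x | x. \<exists>U. simul_diag S U x}"

definition lipschitz_wrt :: "('b::ab_group_add \<Rightarrow> real) \<Rightarrow> real set \<Rightarrow> (real \<Rightarrow> 'b) \<Rightarrow> bool" where
  "lipschitz_wrt N I f \<longleftrightarrow> (\<exists>L\<ge>0. \<forall>s\<in>I. \<forall>t\<in>I. N (f s - f t) \<le> L * \<bar>s - t\<bar>)"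

lemma diag_mat_mult_right: "(A ** diag_mat c) $ i $ j = A $ i $ j * c j"
proof -
  have "(A ** diag_mat c) $ i $ j = (\<Sum>k\<in>UNIV. if k = j then A $ i $ k * c k else 0)"
    by (simp add: matrix_matrix_mult_def diag_mat_def if_distrib cong: if_cong)
  then show ?thesis by simp
qed

lemma diag_mat_mult_left: "(diag_mat c ** A) $ i $ j = c i * A $ i $ j"
proof -
  have "(diag_mat c ** A) $ i $ j = (\<Sum>k\<in>UNIV. if i = k then c i * A $ k $ j else 0)"
    unfolding matrix_matrix_mult_def diag_mat_def
    by (simp only: vec_lambda_beta) (rule sum.cong, auto)
  then show ?thesis by simp
qed

lemma simul_diag_range_subset:
  fixes S :: "complex ^ 'n ^ 'n ^ 'd"
  assumes x: "simul_diag S U x" and y: "simul_diag S V y"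
  shows "range x \<subseteq> range y"
proof
  fix z assume "z \<in> range x"
  then obtain j where z: "z = x j" by auto
  define W where "W = ctranspose V ** U"
  have U: "ctranspose U ** U = mat 1" and V: "V ** ctranspose V = mat 1" "ctranspose V ** V = mat 1"
    using x y by (auto simp: simul_diag_def unitary_def)
  have VW: "V ** W = U"
    by (simp add: W_def matrix_mul_assoc V)
  have "\<exists>i. W $ i $ j \<noteq> 0"
  proof (rule ccontr)
    assume "\<not> ?thesis"
    then have "(V ** W) $ k $ j = 0" for k
      by (simp add: matrix_matrix_mult_def)
    then have "U $ k $ j = 0" for k
      by (simp add: VW)
    then have "(ctranspose U ** U) $ j $ j = 0"
      by (simp add: matrix_matrix_mult_def)
    then show False
      by (simp add: U mat_def)
  qed
  then obtain i where i: "W $ i $ j \<noteq> 0" by blast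
  have "x j $ r = y i $ r" for r
  proof -
    let ?X = "diag_mat (\<lambda>i. complex_of_real (x i $ r))"
    let ?Y = "diag_mat (\<lambda>i. complex_of_real (y i $ r))"
    have eq: "U ** ?X ** ctranspose U = V ** ?Y ** ctranspose V"
      using x y by (metis simul_diag_def)
    have "W ** ?X = ctranspose V ** (U ** ?X ** ctranspose U) ** U"
      by (simp add: W_def matrix_mul_assoc[symmetric] U)
    also have "\<dots> = ?Y ** W"
      unfolding eq by (simp add: W_def matrix_mul_assoc V)
    finally have "(W ** ?X) $ i $ j = (?Y ** W) $ i $ j" by simp
    with i show ?thesis
      by (simp add: diag_mat_mult_left diag_mat_mult_right)
  qed
  then have "z = y i" by (simp add: z vec_eq_iff)
  then show "z \<in> range y" by simp
qed

lemma joint_spectrum_eq: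
  assumes "simul_diag S U x"
  shows "joint_spectrum S = range x"
  using assms simul_diag_range_subset[of S] unfolding joint_spectrum_def by blast

end

theory Submission
  imports Defs
begin

text \<open>The joint spectra at any two times can be matched with an error proportional to
  \<open>\<bar>s - t\<bar>\<close>, and compactness turns these pairwise matchings into one global labelling.

  For the matching, let \<open>U\<close> and \<open>V\<close> diagonalize the commuting tuples \<open>S\<close> and \<open>T\<close>, with joint
  eigenvalues \<open>x\<^sub>i\<close> and \<open>y\<^sub>j\<close>, and let \<open>W = U\<^sup>* V\<close>. The entries of
  \<open>U\<^sup>* (S\<^sup>r - T\<^sup>r) V\<close> are \<open>(x\<^sub>i\<^sup>r - y\<^sub>j\<^sup>r) W\<^sub>i\<^sub>j\<close>, so \<open>x\<^sub>i\<close> and \<open>y\<^sub>j\<close> are close whenever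
  \<open>W\<^sub>i\<^sub>j\<close> is not small. Since \<open>\<bar>det W\<bar> = 1\<close>, the Leibniz formula yields a permutation \<open>p\<close> with
  \<open>\<bar>W\<^sub>i\<^sub>,\<^sub>p\<^sub>i\<bar> \<ge> 1 / n!\<close> for all \<open>i\<close>, and then \<open>\<parallel>x\<^sub>i - y\<^sub>p\<^sub>i\<parallel> \<le> n! \<parallel>S - T\<parallel>\<close>
  (\<open>joint_eigenvalue_matching\<close>). The constant \<open>n!\<close> is far from optimal, but any constant that
  depends on \<open>n\<close> alone serves the purpose. Along an \<open>L\<close>-Lipschitz curve the spectra at times \<open>s\<close>
  and \<open>t\<close> are thus matched within \<open>K \<bar>s - t\<bar>\<close>, where \<open>K = n! L\<close>.

  On finitely many times, matchings between consecutive times compose to a labelling of the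
  spectra by \<open>K\<close>-Lipschitz functions, as distances on the line are additive
  (\<open>lipschitz_labelling_finite\<close>). At each time there are only finitely many labellings, so Tychonoff's
  theorem provides a labelling at all times that satisfies every pairwise Lipschitz constraint
  (\<open>finitely_satisfiable_labelling\<close>).

  The joint eigenvalues themselves come from the spectral theorem for commuting self-adjoint matrices
  (\<open>simul_diag_exists\<close>), proved by splitting off one joint eigenvector at a time.\<close>

section \<open>The Hermitian inner product\<close>

definition cinner :: "complex ^ 'n \<Rightarrow> complex ^ 'n \<Rightarrow> complex" where
  "cinner v w = (\<Sum>k\<in>UNIV. cnj (v $ k) * w $ k)"

lemma cinner_zero_right: "cinner v 0 = 0"
  by (simp add: cinner_def)

lemma cinner_add_right: "cinner v (w + w') = cinner v w + cinner v w'"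
  by (simp add: cinner_def algebra_simps sum.distrib)

lemma cinner_diff_right: "cinner v (w - w') = cinner v w - cinner v w'"
  by (simp add: cinner_def algebra_simps sum_subtractf)

lemma cinner_scale_right: "cinner v (c *s w) = c * cinner v w"
  by (simp add: cinner_def sum_distrib_left mult_ac)

lemma cinner_scale_left: "cinner (c *s v) w = cnj c * cinner v w"
  by (simp add: cinner_def sum_distrib_left mult_ac)

lemma cnj_cinner: "cnj (cinner v w) = cinner w v"
  by (simp add: cinner_def mult_ac)

lemma Re_cinner: "Re (cinner v w) = v \<bullet> w"
  by (simp add: cinner_def inner_vec_def inner_complex_def)

lemma cinner_self: "cinner v v = complex_of_real ((norm v)\<^sup>2)"
proof -
  have "Im (cinner v v) = 0"
    by (simp add: cinner_def mult.commute)
  then show ?thesis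
    by (simp add: complex_eq_iff Re_cinner dot_square_norm)
qed

lemma norm_cinner_le: "norm (cinner v w) \<le> norm v * norm w"
proof -
  have "norm (cinner v w) \<le> (\<Sum>k\<in>UNIV. \<bar>norm (v $ k)\<bar> * \<bar>norm (w $ k)\<bar>)"
    unfolding cinner_def by (rule order_trans[OF norm_sum]) (simp add: norm_mult)
  also have "\<dots> \<le> norm v * norm w"
    unfolding norm_vec_def by (rule L2_set_mult_ineq)
  finally show ?thesis .
qed

lemma cinner_self_adjoint:
  assumes "self_adjoint A"
  shows "cinner (A *v v) w = cinner v (A *v w)"
proof -
  have A: "cnj (A $ i $ j) = A $ j $ i" for i j
  proof -
    have "ctranspose A $ j $ i = A $ j $ i"
      using assms by (simp add: self_adjoint_def)
    then show ?thesis by (simp add: ctranspose_def)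
  qed
  have "cinner (A *v v) w = (\<Sum>i\<in>UNIV. \<Sum>j\<in>UNIV. cnj (v $ j) * A $ j $ i * w $ i)"
    by (simp add: cinner_def matrix_vector_mult_def sum_distrib_left sum_distrib_right A mult_ac)
  also have "\<dots> = (\<Sum>j\<in>UNIV. \<Sum>i\<in>UNIV. cnj (v $ j) * A $ j $ i * w $ i)"
    by (rule sum.swap)
  also have "\<dots> = cinner v (A *v w)"
    by (simp add: cinner_def matrix_vector_mult_def sum_distrib_left mult_ac)
  finally show ?thesis .
qed

lemma ctranspose_mult_nth:
  "(ctranspose V ** A ** U) $ j $ i = cinner (column j V) (A *v column i U)"
  unfolding matrix_mul_assoc[symmetric]
  by (simp add: cinner_def ctranspose_def matrix_matrix_mult_def matrix_vector_mult_def column_def)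

section \<open>Simultaneous diagonalization\<close>

text \<open>For small positive \<open>s\<close> the linear term dominates. Applied to a quadratic function
  with a minimum at 0, this is the first-order condition.\<close>

lemma nonpos_if_linear_le_quadratic:
  fixes a c :: real
  assumes le: "\<And>s. 2 * s * a \<le> s\<^sup>2 * c"
  shows "a \<le> 0"
proof (rule ccontr)
  assume "\<not> ?thesis"
  then have a: "a > 0" by simp
  define b where "b = max 1 c"
  have b: "b > 0" "c \<le> b" by (auto simp: b_def)
  have "2 * (a / b) * a \<le> (a / b)\<^sup>2 * c" by (rule le)
  also have "\<dots> \<le> (a / b)\<^sup>2 * b"
    using b(2) by (rule mult_left_mono) simp
  also have "\<dots> = (a / b) * a"
    using b(1) by (simp add: power2_eq_square)
  finally have "(a / b) * a \<le> 0" by simp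
  moreover have "(a / b) * a > 0" using a b(1) by simp
  ultimately show False by simp
qed

text \<open>The eigenvector is a maximizer \<open>v\<close> of \<open>f v \<bullet> v\<close> on the unit sphere of \<open>E\<close>, with maximum \<open>l\<close>. The
  quadratic form \<open>l * (w \<bullet> w) - f w \<bullet> w\<close> is nonnegative on \<open>E\<close> and vanishes at \<open>v\<close>, so its
  derivative at \<open>v\<close> vanishes in every direction of \<open>E\<close>, in particular in the direction
  \<open>f v - l *\<^sub>R v\<close>; this says that \<open>f v - l *\<^sub>R v\<close> is orthogonal to itself.\<close>

lemma symmetric_has_eigenvector:
  fixes f :: "'a::euclidean_space \<Rightarrow> 'a"
  assumes f: "linear f" and E: "subspace E" and E0: "E \<noteq> {0}"
    and inv: "\<And>v. v \<in> E \<Longrightarrow> f v \<in> E"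
    and sym: "\<And>v w. f v \<bullet> w = v \<bullet> f w"
  shows "\<exists>v l. v \<in> E \<and> v \<noteq> 0 \<and> f v = l *\<^sub>R v"
proof -
  interpret f: linear f by fact
  obtain u where u: "u \<in> E" "u \<noteq> 0"
    using E0 subspace_0[OF E] by blast
  have "compact (E \<inter> sphere 0 1)"
    using closed_subspace[OF E] by (simp add: closed_Int_compact)
  moreover have "u /\<^sub>R norm u \<in> E \<inter> sphere 0 1"
    using u E by (simp add: subspace_scale)
  then have "E \<inter> sphere 0 1 \<noteq> {}" by blast
  moreover have "continuous_on (E \<inter> sphere 0 1) (\<lambda>v. f v \<bullet> v)"
    by (intro continuous_intros linear_continuous_on linear_conv_bounded_linear[THEN iffD1] f)
  ultimately have "\<exists>v\<in>E \<inter> sphere 0 1. \<forall>w\<in>E \<inter> sphere 0 1. f w \<bullet> w \<le> f v \<bullet> v"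
    by (rule continuous_attains_sup)
  then obtain v where v: "v \<in> E \<inter> sphere 0 1"
    and max: "\<And>w. w \<in> E \<inter> sphere 0 1 \<Longrightarrow> f w \<bullet> w \<le> f v \<bullet> v"
    by blast
  define l where "l = f v \<bullet> v"
  have v1: "v \<bullet> v = 1" and vE: "v \<in> E"
    using v by (auto simp: norm_eq_1)
  have nonneg: "f w \<bullet> w \<le> l * (w \<bullet> w)" if "w \<in> E" for w
  proof (cases "w = 0")
    case False
    have "w /\<^sub>R norm w \<in> E \<inter> sphere 0 1"
      using that False E by (simp add: subspace_scale)
    from max[OF this] have "f w \<bullet> w / (norm w)\<^sup>2 \<le> l"
      by (simp add: l_def f.scaleR power2_eq_square divide_simps)
    with False show ?thesis
      by (simp add: field_simps dot_square_norm)
  qed (simp add: f.zero)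
  define w where "w = f v - l *\<^sub>R v"
  have wE: "w \<in> E"
    by (simp add: w_def inv vE E subspace_diff subspace_scale)
  \<comment> \<open>nonnegativity of the form at \<open>v + s *\<^sub>R w\<close>, where the terms without \<open>s\<close> cancel\<close>
  have lin: "2 * s * (w \<bullet> w) \<le> s\<^sup>2 * (l * (w \<bullet> w) - f w \<bullet> w)" for s
  proof -
    have "v + s *\<^sub>R w \<in> E"
      by (simp add: wE vE E subspace_add subspace_scale)
    from nonneg[OF this]
    have "f v \<bullet> v + 2 * s * (f v \<bullet> w) + s\<^sup>2 * (f w \<bullet> w)
        \<le> l * (v \<bullet> v + 2 * s * (v \<bullet> w) + s\<^sup>2 * (w \<bullet> w))"
      using sym[of v w]
      by (simp add: f.add f.scaleR inner_add inner_commute power2_eq_square algebra_simps)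
    moreover have "f v = w + l *\<^sub>R v"
      by (simp add: w_def)
    then have "f v \<bullet> w = w \<bullet> w + l * (v \<bullet> w)"
      by (simp only: inner_add_left inner_scaleR_left)
    ultimately show ?thesis
      using v1 by (simp add: l_def[symmetric] algebra_simps)
  qed
  have "w \<bullet> w \<le> 0"
    using lin by (rule nonpos_if_linear_le_quadratic)
  then have "w = 0"
    using inner_gt_zero_iff[of w] by linarith
  then have "f v = l *\<^sub>R v"
    by (simp add: w_def)
  moreover have "v \<noteq> 0" using v1 by auto
  ultimately show ?thesis using vE by (intro exI conjI)
qed

lemma scaleR_eq_smult: "a *\<^sub>R (v :: complex ^ 'n) = complex_of_real a *s v"
  by (simp add: vec_eq_iff scaleR_conv_of_real[where 'a = complex])

lemma complex_subspace_imp_subspace: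
  fixes E :: "(complex ^ 'n) set"
  shows "vec.subspace E \<Longrightarrow> subspace E"
  by (simp add: vec.subspace_def subspace_def scaleR_eq_smult)

text \<open>In a nonzero invariant complex subspace \<open>F\<close> of least dimension every \<open>S $ r\<close> is a scalar: it has
  an eigenvector in \<open>F\<close>, and since the matrices commute, the eigenspace in \<open>F\<close> is again invariant
  under all of them, so it is all of \<open>F\<close> by minimality. Hence any nonzero vector of \<open>F\<close> will do.
  The real dimension serves to measure size, because the eigenvalue lemma treats \<open>complex ^ 'n\<close> as a
  real Euclidean space and thereby yields real eigenvalues at once.\<close>

lemma joint_eigenvector:
  fixes S :: "complex ^ 'n ^ 'n ^ 'd"
  assumes S: "S \<in> commuting_self_adjoint" and E: "vec.subspace E" "E \<noteq> {0}"
    and inv: "\<And>r v. v \<in> E \<Longrightarrow> S $ r *v v \<in> E"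
  shows "\<exists>v (x :: real ^ 'd). v \<in> E \<and> v \<noteq> 0 \<and>
    (\<forall>r. S $ r *v v = complex_of_real (x $ r) *s v)"
proof -
  define P where
    "P F \<longleftrightarrow> vec.subspace F \<and> F \<noteq> {0} \<and> F \<subseteq> E \<and> (\<forall>r. \<forall>v\<in>F. S $ r *v v \<in> F)" for F
  have "P E" using E inv by (auto simp: P_def)
  then obtain F where PF: "P F" and min: "\<And>G. P G \<Longrightarrow> dim F \<le> dim G"
    using ex_has_least_nat[of P E dim] by blast
  have F: "vec.subspace F" "F \<noteq> {0}" "F \<subseteq> E" "\<And>r v. v \<in> F \<Longrightarrow> S $ r *v v \<in> F"
    using PF by (auto simp: P_def)
  have sub: "subspace F" by (rule complex_subspace_imp_subspace) fact
  have eig: "\<exists>l. \<forall>v\<in>F. S $ r *v v = complex_of_real l *s v" for r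
  proof -
    have sa: "self_adjoint (S $ r)"
      using S by (simp add: commuting_self_adjoint_def)
    have "(S $ r *v v) \<bullet> w = v \<bullet> (S $ r *v w)" for v w
      unfolding Re_cinner[symmetric] by (simp only: cinner_self_adjoint[OF sa])
    then have "\<exists>v l. v \<in> F \<and> v \<noteq> 0 \<and> S $ r *v v = l *\<^sub>R v"
      by (intro symmetric_has_eigenvector matrix_vector_mul_linear sub F)
    then obtain v l where v: "v \<in> F" "v \<noteq> 0" "S $ r *v v = l *\<^sub>R v"
      by (elim exE conjE)
    define G where "G = {v \<in> F. S $ r *v v = complex_of_real l *s v}"
    have "vec.subspace G"
      using F(1) unfolding vec.subspace_def G_def
      by (simp add: matrix_vector_right_distrib vector_scalar_commute vector_add_ldistrib
          vector_smult_assoc mult.commute)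
    moreover have "G \<noteq> {0}"
      using v by (auto simp: G_def scaleR_eq_smult)
    moreover have "S $ s *v w \<in> G" if "w \<in> G" for s w
    proof -
      have "S $ r *v (S $ s *v w) = S $ s *v (S $ r *v w)"
        using S by (simp add: commuting_self_adjoint_def matrix_vector_mul_assoc)
      also have "\<dots> = complex_of_real l *s (S $ s *v w)"
        using that by (simp add: G_def vector_scalar_commute)
      finally show ?thesis
        using that F(4) by (simp add: G_def)
    qed
    moreover have "G \<subseteq> F" by (auto simp: G_def)
    ultimately have "P G" using F(3) unfolding P_def by (intro conjI allI ballI) auto
    then have "G = F"
      using complex_subspace_imp_subspace[OF \<open>vec.subspace G\<close>] sub \<open>G \<subseteq> F\<close> min[OF \<open>P G\<close>]
      by (intro subspace_dim_equal)
    then have "\<forall>v\<in>F. v \<in> G" by simp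
    then show ?thesis unfolding G_def by (intro exI[of _ l]) simp
  qed
  then have "\<forall>r. \<exists>l. \<forall>v\<in>F. S $ r *v v = complex_of_real l *s v" by (rule allI)
  from choice[OF this] obtain l
    where l: "\<forall>r. \<forall>v\<in>F. S $ r *v v = complex_of_real (l r) *s v" ..
  have "0 \<in> F" using sub by (rule subspace_0)
  with F(2) obtain v where v: "v \<in> F" "v \<noteq> 0" by blast
  show ?thesis
  proof (intro exI conjI allI)
    show "v \<in> E" using v(1) F(3) by blast
    show "S $ r *v v = complex_of_real ((\<chi> r. l r) $ r) *s v" for r
      using l v(1) by simp
  qed fact
qed

text \<open>Fewer than \<open>n\<close> linear conditions have a nonzero solution: padded with a zero row for the index
  \<open>a\<close>, they form a square matrix that is singular.\<close>

lemma nonzero_orthogonal_vector: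
  fixes u :: "'n::finite \<Rightarrow> complex ^ 'n"
  assumes "a \<notin> A"
  obtains v where "v \<noteq> 0" "\<And>i. i \<in> A \<Longrightarrow> cinner (u i) v = 0"
proof -
  define M :: "complex ^ 'n ^ 'n" where "M = (\<chi> i k. if i \<in> A then cnj (u i $ k) else 0)"
  have "row a M = 0"
    using assms by (simp add: M_def row_def vec_eq_iff)
  then have "\<not> invertible M"
    by (simp add: invertible_det_nz det_zero_row)
  then obtain v where v: "M *v v = 0" "v \<noteq> 0"
    unfolding invertible_left_inverse matrix_left_invertible_ker by blast
  have "cinner (u i) v = 0" if "i \<in> A" for i
  proof -
    have "cinner (u i) v = (M *v v) $ i"
      using that by (simp add: cinner_def M_def matrix_vector_mult_def)
    then show ?thesis by (simp add: v)
  qed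
  with v that show ?thesis by blast
qed

text \<open>Induction on the index set. The orthogonal complement of joint eigenvectors is invariant under the
  self-adjoint matrices and contains a further joint eigenvector, being nonzero as long as an index is left over.\<close>

lemma orthonormal_joint_eigenvectors:
  fixes S :: "complex ^ 'n ^ 'n ^ 'd" and A :: "'n set"
  assumes S: "S \<in> commuting_self_adjoint"
  shows "\<exists>(u :: 'n \<Rightarrow> complex ^ 'n) (x :: 'n \<Rightarrow> real ^ 'd).
    (\<forall>i\<in>A. \<forall>j\<in>A. cinner (u i) (u j) = (if i = j then 1 else 0)) \<and>
    (\<forall>i\<in>A. \<forall>r. S $ r *v u i = complex_of_real (x i $ r) *s u i)"
  using finite[of A]
proof (induction A rule: finite_induct)
  case (insert a A)
  then obtain u :: "'n \<Rightarrow> complex ^ 'n" and x :: "'n \<Rightarrow> real ^ 'd" where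
    ortho: "\<And>i j. i \<in> A \<Longrightarrow> j \<in> A \<Longrightarrow> cinner (u i) (u j) = (if i = j then 1 else 0)" and
    eig: "\<And>i r. i \<in> A \<Longrightarrow> S $ r *v u i = complex_of_real (x i $ r) *s u i"
    by blast
  define E where "E = {v. \<forall>i\<in>A. cinner (u i) v = 0}"
  have E1: "vec.subspace E"
    by (auto simp: vec.subspace_def E_def cinner_zero_right cinner_add_right cinner_scale_right)
  have E2: "E \<noteq> {0}"
  proof -
    obtain w where "w \<noteq> 0" "\<And>i. i \<in> A \<Longrightarrow> cinner (u i) w = 0"
      using nonzero_orthogonal_vector[OF insert.hyps(2), of u] by blast
    then show ?thesis by (auto simp: E_def)
  qed
  have E3: "S $ r *v v \<in> E" if "v \<in> E" for r v
  proof -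
    have "self_adjoint (S $ r)"
      using S by (simp add: commuting_self_adjoint_def)
    then show ?thesis
      using that by (simp add: E_def cinner_self_adjoint[symmetric] eig cinner_scale_left)
  qed
  have "\<exists>v (y :: real ^ 'd). v \<in> E \<and> v \<noteq> 0 \<and>
      (\<forall>r. S $ r *v v = complex_of_real (y $ r) *s v)"
    by (rule joint_eigenvector[OF S E1 E2]) (rule E3)
  then obtain v and y :: "real ^ 'd" where v: "v \<in> E" "v \<noteq> 0"
    and eigv: "\<forall>r. S $ r *v v = complex_of_real (y $ r) *s v"
    by (elim exE conjE)
  define e where "e = complex_of_real (1 / norm v) *s v"
  have "norm e = 1"
    using v(2) unfolding e_def scaleR_eq_smult[symmetric] by simp
  then have ee: "cinner e e = 1"
    by (simp add: cinner_self)
  have ue: "cinner (u i) e = 0" if "i \<in> A" for i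
    using that v(1) by (simp add: e_def cinner_scale_right E_def)
  have eu: "cinner e (u i) = 0" if "i \<in> A" for i
    using ue[OF that] by (metis cnj_cinner complex_cnj_zero)
  have eige: "S $ r *v e = complex_of_real (y $ r) *s e" for r
    by (simp add: e_def vector_scalar_commute eigv[rule_format] vector_smult_assoc mult.commute)
  have "cinner ((u(a := e)) i) ((u(a := e)) j) = (if i = j then 1 else 0)"
    if "i \<in> insert a A" "j \<in> insert a A" for i j
    using that insert.hyps(2) by (auto simp: ee ue eu ortho)
  moreover have "S $ r *v (u(a := e)) i = complex_of_real ((x(a := y)) i $ r) *s (u(a := e)) i"
    if "i \<in> insert a A" for i r
    using that by (cases "i = a") (simp_all add: eige eig)
  ultimately show ?case by (intro exI conjI ballI allI)
qed simp

lemma simul_diag_exists: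
  fixes S :: "complex ^ 'n ^ 'n ^ 'd"
  assumes S: "S \<in> commuting_self_adjoint"
  obtains U x where "simul_diag S U x"
proof -
  obtain u :: "'n \<Rightarrow> complex ^ 'n" and x :: "'n \<Rightarrow> real ^ 'd" where
    ortho: "\<And>i j. cinner (u i) (u j) = (if i = j then 1 else 0)" and
    eig: "\<And>i r. S $ r *v u i = complex_of_real (x i $ r) *s u i"
    using orthonormal_joint_eigenvectors[OF S, of UNIV] by fast
  define U where "U = (\<chi> k i. u i $ k)"
  have col: "column i U = u i" for i
    by (simp add: U_def column_def vec_eq_iff)
  have "(ctranspose U ** U) $ i $ j = cinner (u i) (u j)" for i j
    using ctranspose_mult_nth[of U "mat 1" U i j] by (simp add: col)
  then have UU: "ctranspose U ** U = mat 1"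
    by (simp add: vec_eq_iff mat_def ortho)
  then have U: "unitary U"
    by (simp add: unitary_def matrix_left_right_inverse)
  have "S $ r = U ** diag_mat (\<lambda>i. complex_of_real (x i $ r)) ** ctranspose U" for r
  proof -
    have "(S $ r ** U) $ k $ i = (U ** diag_mat (\<lambda>i. complex_of_real (x i $ r))) $ k $ i" for k i
    proof -
      have "(S $ r ** U) $ k $ i = (S $ r *v u i) $ k"
        by (simp add: matrix_matrix_mult_def matrix_vector_mult_def U_def)
      then show ?thesis
        by (simp add: eig diag_mat_mult_right U_def)
    qed
    then have "S $ r ** U = U ** diag_mat (\<lambda>i. complex_of_real (x i $ r))"
      by (simp add: vec_eq_iff)
    then show ?thesis
      using U by (metis matrix_mul_assoc matrix_mul_rid unitary_def)
  qed
  with U have "simul_diag S U x" by (simp only: simul_diag_def simp_thms)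
  then show ?thesis by (rule that)
qed

section \<open>Matching nearby joint spectra\<close>

lemma ctranspose_ctranspose: "ctranspose (ctranspose A) = A"
  by (simp add: ctranspose_def vec_eq_iff)

lemma ctranspose_mult: "ctranspose (A ** B) = ctranspose B ** ctranspose A"
  by (simp add: ctranspose_def vec_eq_iff matrix_matrix_mult_def mult.commute)

lemma unitary_ctranspose_mult:
  assumes "unitary U" "unitary V"
  shows "unitary (ctranspose U ** V)"
proof -
  have "ctranspose (ctranspose U ** V) ** (ctranspose U ** V)
      = ctranspose V ** (U ** ctranspose U) ** V"
    by (simp add: ctranspose_mult ctranspose_ctranspose matrix_mul_assoc)
  also have "\<dots> = mat 1"
    using assms by (simp add: unitary_def)
  finally show ?thesis
    by (simp add: unitary_def matrix_left_right_inverse)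
qed

lemma norm_column_unitary:
  assumes "unitary U"
  shows "norm (column i U) = 1"
proof -
  have "cinner (column i U) (column i U) = (ctranspose U ** U) $ i $ i"
    using ctranspose_mult_nth[of U "mat 1" U i i] by simp
  also have "\<dots> = 1"
    using assms by (simp add: unitary_def mat_def)
  finally have "(norm (column i U))\<^sup>2 = 1"
    by (metis cinner_self of_real_eq_1_iff)
  then show ?thesis
    by (intro power2_eq_imp_eq[of _ 1]) auto
qed

lemma det_ctranspose: "det (ctranspose A) = cnj (det A)"
proof -
  have "ctranspose A = transpose (\<chi> i j. cnj (A $ i $ j))"
    by (simp add: ctranspose_def transpose_def vec_eq_iff)
  then have "det (ctranspose A) = det (\<chi> i j. cnj (A $ i $ j))"
    by (simp only: det_transpose)
  also have "\<dots> = cnj (det A)"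
    by (simp add: det_def)
  finally show ?thesis .
qed

lemma norm_det_unitary:
  assumes "unitary U"
  shows "norm (det U) = 1"
proof -
  have "det U * cnj (det U) = 1"
    using assms by (metis det_I det_ctranspose det_mul unitary_def)
  then have "norm (det U) * norm (det U) = 1"
    by (metis complex_mod_cnj norm_mult norm_one)
  then show ?thesis
    by (intro power2_eq_imp_eq[of _ 1]) (auto simp: power2_eq_square)
qed

text \<open>The Leibniz formula writes \<open>det W\<close>, of absolute value 1, as a sum of \<open>n!\<close> signed products, so
  one of these products has absolute value at least \<open>1 / n!\<close>. The entries of \<open>W\<close> are bounded by 1,
  so this lower bound passes from the product to each of its factors.\<close>

lemma unitary_large_transversal:
  fixes W :: "complex ^ 'n ^ 'n"
  assumes W: "unitary W"
  obtains p where "bij p" "\<And>i. norm (W $ i $ p i) \<ge> 1 / fact CARD('n)"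
proof -
  have le1: "norm (W $ i $ j) \<le> 1" for i j
  proof -
    have "norm (column j W $ i) \<le> norm (column j W)"
      by (rule Finite_Cartesian_Product.norm_nth_le)
    then show ?thesis
      using norm_column_unitary[OF W, of j] by (simp add: column_def)
  qed
  let ?P = "{p. p permutes (UNIV :: 'n set)}"
  have "\<exists>p\<in>?P. (\<Prod>i\<in>UNIV. norm (W $ i $ p i)) \<ge> 1 / fact CARD('n)"
  proof (rule ccontr)
    assume "\<not> ?thesis"
    then have less: "\<And>p. p \<in> ?P \<Longrightarrow> (\<Prod>i\<in>UNIV. norm (W $ i $ p i)) < 1 / fact CARD('n)"
      by force
    have card: "card ?P = fact CARD('n)"
      by (rule card_permutations) auto
    have "norm (det W) \<le> (\<Sum>p\<in>?P. norm (of_int (sign p) * (\<Prod>i\<in>UNIV. W $ i $ p i)))"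
      unfolding det_def by (rule norm_sum)
    also have "\<dots> = (\<Sum>p\<in>?P. \<Prod>i\<in>UNIV. norm (W $ i $ p i))"
      by (rule sum.cong) (auto simp: norm_mult prod_norm sign_def)
    also have "\<dots> < of_nat (card ?P) * (1 / fact CARD('n))"
      by (rule sum_bounded_above_strict) (use less card in auto)
    also have "\<dots> = 1"
      by (simp add: card)
    finally show False
      by (simp add: norm_det_unitary[OF W])
  qed
  then obtain p where p: "p permutes UNIV"
    and large: "(\<Prod>i\<in>UNIV. norm (W $ i $ p i)) \<ge> 1 / fact CARD('n)"
    by auto
  have "norm (W $ i $ p i) \<ge> 1 / fact CARD('n)" for i
  proof -
    have "(\<Prod>k\<in>UNIV. norm (W $ k $ p k))
        = norm (W $ i $ p i) * (\<Prod>k\<in>UNIV - {i}. norm (W $ k $ p k))"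
      by (simp add: prod.remove)
    also have "\<dots> \<le> norm (W $ i $ p i) * 1"
      by (intro mult_left_mono prod_le_1) (auto simp: le1)
    finally show ?thesis using large by simp
  qed
  with p that show ?thesis by (auto dest: permutes_bij)
qed

lemma onorm_component_le_tuple_norm: "onorm (\<lambda>v. A $ r *v v) \<le> tuple_norm A"
  unfolding tuple_norm_def by (rule Max_ge) auto

lemma infnorm_le:
  fixes x :: "real ^ 'd"
  assumes "\<And>r. \<bar>x $ r\<bar> \<le> c"
  shows "infnorm x \<le> c"
  unfolding infnorm_cart using assms by (intro cSup_least) auto

text \<open>With the transition matrix \<open>W = U\<^sup>* V\<close> between the two eigenbases, the \<open>(i, j)\<close> entry of
  \<open>U\<^sup>* (S\<^sup>r - T\<^sup>r) V\<close> is \<open>(x\<^sub>i\<^sup>r - y\<^sub>j\<^sup>r) W\<^sub>i\<^sub>j\<close>, and its absolute value is at most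
  \<open>\<parallel>S - T\<parallel>\<close>. Joint eigenvalues whose eigenvectors overlap substantially are therefore close, and
  a large transversal of \<open>W\<close> pairs all of them in this way at once.\<close>

lemma joint_eigenvalue_matching:
  fixes S T :: "complex ^ 'n ^ 'n ^ 'd"
  assumes S: "simul_diag S U x" and T: "simul_diag T V y"
  obtains p where "bij p"
    and "\<And>i. infnorm (x i - y (p i)) \<le> fact CARD('n) * tuple_norm (S - T)"
proof -
  have uni: "unitary U" "unitary V"
    using S T by (auto simp: simul_diag_def)
  define W where "W = ctranspose U ** V"
  obtain p where p: "bij p" "\<And>i. norm (W $ i $ p i) \<ge> 1 / fact CARD('n)"
    using unitary_large_transversal unitary_ctranspose_mult[OF uni] unfolding W_def by blast
  have gap: "\<bar>x i $ r - y j $ r\<bar> * norm (W $ i $ j) \<le> tuple_norm (S - T)" for i j r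
  proof -
    let ?X = "diag_mat (\<lambda>i. complex_of_real (x i $ r))"
    let ?Y = "diag_mat (\<lambda>i. complex_of_real (y i $ r))"
    have "ctranspose U ** S $ r ** V = (ctranspose U ** U) ** ?X ** W"
      using S by (simp add: simul_diag_def W_def matrix_mul_assoc)
    then have SW: "ctranspose U ** S $ r ** V = ?X ** W"
      using uni by (simp add: unitary_def)
    have "ctranspose U ** T $ r ** V = W ** ?Y ** (ctranspose V ** V)"
      using T by (simp add: simul_diag_def W_def matrix_mul_assoc)
    then have TW: "ctranspose U ** T $ r ** V = W ** ?Y"
      using uni by (simp add: unitary_def)
    have "complex_of_real (x i $ r - y j $ r) * W $ i $ j
        = (ctranspose U ** S $ r ** V) $ i $ j - (ctranspose U ** T $ r ** V) $ i $ j"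
      by (simp add: SW TW diag_mat_mult_left diag_mat_mult_right algebra_simps)
    also have "\<dots> = cinner (column i U) ((S - T) $ r *v column j V)"
      by (simp add: ctranspose_mult_nth cinner_diff_right matrix_vector_mult_diff_rdistrib)
    finally have "\<bar>x i $ r - y j $ r\<bar> * norm (W $ i $ j)
        = norm (cinner (column i U) ((S - T) $ r *v column j V))"
      by (metis norm_mult norm_of_real)
    also have "\<dots> \<le> norm ((S - T) $ r *v column j V)"
      using norm_cinner_le[of "column i U"] by (simp add: norm_column_unitary uni)
    also have "\<dots> \<le> onorm (\<lambda>v. (S - T) $ r *v v)"
      using onorm[OF matrix_vector_mul_bounded_linear, of "(S - T) $ r" "column j V"]
      by (simp add: norm_column_unitary uni)
    also have "\<dots> \<le> tuple_norm (S - T)"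
      by (rule onorm_component_le_tuple_norm)
    finally show ?thesis .
  qed
  have "infnorm (x i - y (p i)) \<le> fact CARD('n) * tuple_norm (S - T)" for i
  proof (rule infnorm_le)
    fix r
    have "\<bar>x i $ r - y (p i) $ r\<bar> * (1 / fact CARD('n)) \<le> tuple_norm (S - T)"
      using gap[of i r "p i"] mult_left_mono[OF p(2)[of i], of "\<bar>x i $ r - y (p i) $ r\<bar>"]
      by simp
    then show "\<bar>(x i - y (p i)) $ r\<bar> \<le> fact CARD('n) * tuple_norm (S - T)"
      by (simp add: field_simps)
  qed
  with p(1) that show ?thesis by blast
qed

section \<open>Lipschitz selections from matchings\<close>

text \<open>By Tychonoff's theorem the labellings of \<open>I\<close> by a finite discrete set form a compact space. Each
  constraint concerns two coordinates only and so defines a closed set. By hypothesis these closed sets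
  have the finite intersection property, so they have a common point.\<close>

lemma finitely_satisfiable_labelling:
  fixes R :: "'a \<Rightarrow> 'a \<Rightarrow> 'c::finite \<Rightarrow> 'c \<Rightarrow> bool"
  assumes fin: "\<And>F. finite F \<Longrightarrow> F \<subseteq> I \<Longrightarrow> \<exists>p. \<forall>s\<in>F. \<forall>t\<in>F. R s t (p s) (p t)"
  shows "\<exists>p. \<forall>s\<in>I. \<forall>t\<in>I. R s t (p s) (p t)"
proof -
  define X where "X = product_topology (\<lambda>_. discrete_topology (UNIV :: 'c set)) I"
  define C where "C = (\<lambda>(s, t). {p \<in> topspace X. R s t (p s) (p t)})"
  have coord: "closedin X {p \<in> topspace X. p s = a}" if "s \<in> I" for s a
  proof -
    have "continuous_map X (discrete_topology UNIV) (\<lambda>p. p s)"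
      using that unfolding X_def by (rule continuous_map_product_projection)
    from closedin_continuous_map_preimage[OF this, of "{a}"] show ?thesis by simp
  qed
  have "compact_space X"
    by (simp add: X_def compact_space_product_topology compact_space_discrete_topology)
  moreover have "closedin X (C st)" if st: "st \<in> I \<times> I" for st
  proof -
    obtain s t where [simp]: "st = (s, t)" and I: "s \<in> I" "t \<in> I" using st by blast
    \<comment> \<open>a finite union, since the label type is finite\<close>
    have "C st = (\<Union>(a, b)\<in>{(a, b). R s t a b}.
        {p \<in> topspace X. p s = a} \<inter> {p \<in> topspace X. p t = b})"
      by (auto simp: C_def)
    moreover have "closedin X \<dots>"
    proof (rule closedin_Union, goal_cases)
      case (2 T)
      then show ?case
        by (auto intro!: closedin_Int coord I)
    qed simp
    ultimately show ?thesis by simp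
  qed
  moreover have "\<Inter>\<F> \<noteq> {}" if "finite \<F>" "\<F> \<subseteq> C ` (I \<times> I)" for \<F>
  proof -
    from finite_subset_image[OF that] obtain P
      where P: "P \<subseteq> I \<times> I" "finite P" "\<F> = C ` P"
      by auto
    define F where "F = fst ` P \<union> snd ` P"
    have "finite F" "F \<subseteq> I" using P by (auto simp: F_def)
    from fin[OF this] obtain p where p: "\<forall>s\<in>F. \<forall>t\<in>F. R s t (p s) (p t)" by blast
    have q: "restrict p I \<in> topspace X" by (simp add: X_def)
    have "restrict p I \<in> C st" if "st \<in> P" for st
    proof -
      obtain s t where st: "st = (s, t)" by (cases st)
      have "s \<in> F" "t \<in> F"
        using that st by (force simp: F_def)+
      then show ?thesis
        using p q \<open>F \<subseteq> I\<close> st by (auto simp: C_def)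
    qed
    with P(3) have "restrict p I \<in> \<Inter>\<F>" by blast
    then show ?thesis by blast
  qed
  ultimately have "\<Inter> (C ` (I \<times> I)) \<noteq> {}"
    unfolding compact_space_fip by (elim allE[of _ "C ` (I \<times> I)"]) auto
  then obtain p where "p \<in> \<Inter> (C ` (I \<times> I))" by blast
  then have "\<forall>s\<in>I. \<forall>t\<in>I. R s t (p s) (p t)" by (auto simp: C_def)
  then show ?thesis by blast
qed

text \<open>Order the points of \<open>F\<close> and carry the labels from each point to the next by a matching. For points
  far apart the errors of the intermediate steps add up, but so do the distances \<open>\<bar>s - t\<bar>\<close> along the
  line, and the constant \<open>K\<close> is preserved. That the constant is independent of the
  number of points is what makes the passage to infinite sets possible.\<close>

lemma lipschitz_labelling_finite:
  fixes y :: "'n \<Rightarrow> real \<Rightarrow> 'b::euclidean_space"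
  assumes match: "\<And>s t. s \<in> I \<Longrightarrow> t \<in> I \<Longrightarrow>
      \<exists>p :: 'n \<Rightarrow> 'n. bij p \<and> (\<forall>i. infnorm (y i s - y (p i) t) \<le> K * \<bar>s - t\<bar>)"
    and F: "finite F" "F \<subseteq> I"
  shows "\<exists>p :: real \<Rightarrow> 'n \<Rightarrow> 'n. \<forall>s\<in>F. \<forall>t\<in>F. bij (p s) \<and> bij (p t) \<and>
      (\<forall>i. infnorm (y (p s i) s - y (p t i) t) \<le> K * \<bar>s - t\<bar>)"
  using F
proof (induction F rule: finite_linorder_max_induct)
  case (insert b A)
  show ?case
  proof (cases "A = {}")
    case True
    then show ?thesis
      by (intro exI[of _ "\<lambda>_. id"]) (simp add: infnorm_0 bij_id[unfolded id_def] id_def)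
  next
    case False
    obtain p :: "real \<Rightarrow> 'n \<Rightarrow> 'n" where p: "\<And>s t. s \<in> A \<Longrightarrow> t \<in> A \<Longrightarrow> bij (p s) \<and>
        (\<forall>i. infnorm (y (p s i) s - y (p t i) t) \<le> K * \<bar>s - t\<bar>)"
      using insert.IH insert.prems by auto
    define m where "m = Max A"
    have m: "m \<in> A" "\<And>s. s \<in> A \<Longrightarrow> s \<le> m"
      using False insert.hyps by (auto simp: m_def)
    then have "m \<in> I" "b \<in> I" "m < b"
      using insert.hyps insert.prems by auto
    then obtain q where q: "bij q" "\<And>i. infnorm (y i m - y (q i) b) \<le> K * \<bar>m - b\<bar>"
      using match by blast
    define p' where "p' = p(b := q \<circ> p m)"
    have p'A: "p' s = p s" if "s \<in> A" for s
      using that insert.hyps(2) by (auto simp: p'_def)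
    have bA: "infnorm (y (p' s i) s - y (p' b i) b) \<le> K * \<bar>s - b\<bar>" if s: "s \<in> A" for s i
    proof -
      have "infnorm (y (p s i) s - y (q (p m i)) b)
          \<le> infnorm (y (p s i) s - y (p m i) m) + infnorm (y (p m i) m - y (q (p m i)) b)"
        using infnorm_triangle[of "y (p s i) s - y (p m i) m" "y (p m i) m - y (q (p m i)) b"]
        by simp
      also have "\<dots> \<le> K * \<bar>s - m\<bar> + K * \<bar>m - b\<bar>"
        using p[OF s m(1)] q(2) by (intro add_mono) auto
      \<comment> \<open>additivity of distance along the line, as \<open>s \<le> m < b\<close>\<close>
      also have "\<dots> = K * \<bar>s - b\<bar>"
        using m(2)[OF s] \<open>m < b\<close> by (simp add: algebra_simps)
      finally show ?thesis using s insert.hyps(2) by (auto simp: p'_def)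
    qed
    have "bij (p' s)" if "s \<in> insert b A" for s
      using that p[of s s] p[of m m] m(1) q(1) by (auto simp: p'_def bij_comp)
    moreover have "infnorm (y (p' s i) s - y (p' t i) t) \<le> K * \<bar>s - t\<bar>"
      if st: "s \<in> insert b A" "t \<in> insert b A" for s t i
    proof -
      consider "s = b" "t = b" | "s \<in> A" "t = b" | "s = b" "t \<in> A" | "s \<in> A" "t \<in> A"
        using st by blast
      then show ?thesis
      proof cases
        case 3
        then show ?thesis using bA[of t i] by (simp add: infnorm_sub abs_minus_commute)
      qed (use bA p in \<open>auto simp: infnorm_0 p'A\<close>)
    qed
    ultimately show ?thesis by blast
  qed
qed simp

text \<open>Any enumeration \<open>y\<close> of the point sets can be relabelled at each time by a permutation. The
  requirement that the relabelled functions be \<open>K\<close>-Lipschitz is a constraint on the permutations at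
  two times, and permutations form a finite set, so solvability on finite sets suffices.\<close>

lemma lipschitz_selection:
  fixes y :: "'n::finite \<Rightarrow> real \<Rightarrow> 'b::euclidean_space"
  assumes "\<And>s t. s \<in> I \<Longrightarrow> t \<in> I \<Longrightarrow>
      \<exists>p :: 'n \<Rightarrow> 'n. bij p \<and> (\<forall>i. infnorm (y i s - y (p i) t) \<le> K * \<bar>s - t\<bar>)"
  obtains x :: "'n \<Rightarrow> real \<Rightarrow> 'b"
  where "\<And>i s t. s \<in> I \<Longrightarrow> t \<in> I \<Longrightarrow> infnorm (x i s - x i t) \<le> K * \<bar>s - t\<bar>"
    and "\<And>t. t \<in> I \<Longrightarrow> range (\<lambda>i. x i t) = range (\<lambda>i. y i t)"
proof -
  define R where "R s t p q \<longleftrightarrow> bij p \<and> bij q \<and>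
      (\<forall>i. infnorm (y (p i) s - y (q i) t) \<le> K * \<bar>s - t\<bar>)" for s t and p q :: "'n \<Rightarrow> 'n"
  have fin: "\<exists>p :: real \<Rightarrow> 'n \<Rightarrow> 'n. \<forall>s\<in>F. \<forall>t\<in>F. R s t (p s) (p t)" if "finite F" "F \<subseteq> I" for F
    unfolding R_def using assms that by (rule lipschitz_labelling_finite)
  have "\<exists>p. \<forall>s\<in>I. \<forall>t\<in>I. R s t (p s) (p t)"
    by (rule finitely_satisfiable_labelling) (rule fin)
  then obtain p where p: "\<And>s t. s \<in> I \<Longrightarrow> t \<in> I \<Longrightarrow> R s t (p s) (p t)"
    by blast
  have "range (\<lambda>i. y (p t i) t) = range (\<lambda>i. y i t)" if "t \<in> I" for t
  proof -
    have "range (p t) = UNIV"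
      using p[OF that that] by (simp add: R_def bij_is_surj)
    moreover have "range (\<lambda>i. y (p t i) t) = (\<lambda>i. y i t) ` range (p t)"
      by (simp add: image_image)
    ultimately show ?thesis by simp
  qed
  then show ?thesis
    using that[of "\<lambda>i t. y (p t i) t"] p by (simp add: R_def)
qed

section \<open>Lipschitz parametrization of the joint spectrum\<close>

theorem theorem2p5:
  fixes S :: "real \<Rightarrow> complex ^ 'n ^ 'n ^ 'd" and I :: "real set"
  assumes "is_interval I"
    and "\<And>t. t \<in> I \<Longrightarrow> S t \<in> commuting_self_adjoint"
    and "lipschitz_wrt tuple_norm I S"
  shows "\<exists>x :: 'n \<Rightarrow> real \<Rightarrow> real ^ 'd.
           (\<forall>i. lipschitz_wrt infnorm I (x i)) \<and>
           (\<forall>t\<in>I. joint_spectrum (S t) = {x i t | i. True})"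
proof -
  obtain L where L: "L \<ge> 0" "\<And>s t. s \<in> I \<Longrightarrow> t \<in> I \<Longrightarrow> tuple_norm (S s - S t) \<le> L * \<bar>s - t\<bar>"
    using assms(3) by (auto simp: lipschitz_wrt_def)
  have "\<exists>U z. simul_diag (S t) U z" if "t \<in> I" for t
    using simul_diag_exists[OF assms(2)[OF that]] by blast
  then obtain U z where z: "\<And>t. t \<in> I \<Longrightarrow> simul_diag (S t) (U t) (z t)"
    by metis
  define y where "y = (\<lambda>i t. z t i)"
  define K where "K = fact CARD('n) * L"
  have "\<exists>p :: 'n \<Rightarrow> 'n. bij p \<and> (\<forall>i. infnorm (y i s - y (p i) t) \<le> K * \<bar>s - t\<bar>)"
    if st: "s \<in> I" "t \<in> I" for s t
  proof -
    obtain p where p: "bij p"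
      "\<And>i. infnorm (z s i - z t (p i)) \<le> fact CARD('n) * tuple_norm (S s - S t)"
      using joint_eigenvalue_matching[OF z[OF st(1)] z[OF st(2)]] by blast
    have "fact CARD('n) * tuple_norm (S s - S t) \<le> K * \<bar>s - t\<bar>"
      unfolding K_def mult.assoc by (intro mult_left_mono L(2) st) simp
    then have "infnorm (y i s - y (p i) t) \<le> K * \<bar>s - t\<bar>" for i
      unfolding y_def using p(2)[of i] by (rule order_trans[rotated])
    with p(1) show ?thesis by blast
  qed
  then obtain x :: "'n \<Rightarrow> real \<Rightarrow> real ^ 'd"
    where lip: "\<And>i s t. s \<in> I \<Longrightarrow> t \<in> I \<Longrightarrow> infnorm (x i s - x i t) \<le> K * \<bar>s - t\<bar>"
      and range: "\<And>t. t \<in> I \<Longrightarrow> range (\<lambda>i. x i t) = range (\<lambda>i. y i t)"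
    using lipschitz_selection[of I y K] by blast
  have "K \<ge> 0"
    using L(1) by (simp add: K_def)
  then have "lipschitz_wrt infnorm I (x i)" for i
    using lip by (auto simp: lipschitz_wrt_def)
  moreover have "joint_spectrum (S t) = {x i t | i. True}" if "t \<in> I" for t
    using joint_spectrum_eq[OF z[OF that]] range[OF that] by (auto simp: y_def full_SetCompr_eq)
  ultimately show ?thesis by blast
qed

end
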